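(* All of the unitary groups $(\mathbf 1+\mathcal F)\cap U(\mathcal H)$, $U_{1,2}$, and $U_{\mathrm{res}}$ are unbounded subsets of the unital associative Banach algebra $\mathcal B_{\mathrm{res}}$.
   Context: $\mathcal H=\mathcal H_+\oplus\mathcal H_-$ is a separable complex Hilbert space written as an orthogonal sum of two closed infinite-dimensional subspaces, $p_\pm$ are the orthogonal projections onto $\mathcal H_\pm$, $d=i(p_+-p_-)$. $\mathfrak S_1,\mathfrak S_2$ denote trace class and Hilbert-Schmidt operators, $\mathcal F$ the finite-rank operators on $\mathcal H$, and $U(\mathcal H)$ the unitary group. $\mathcal B_{\mathrm{res}}=\{a\in\mathcal B(\mathcal H)\mid[d,a]\in\mathfrak S_2(\mathcal H)\}$ with norm $\|a\|_{\mathrm{res}}=\|a\|+\|[d,a]\|_2$; $U_{\mathrm{res}}=U(\mathcal H)\cap\mathcal B_{\mathrm{res}}$; $U_{1,2}=\{a\in U(\mathcal H)\mid a-\mathrm{id}\in\mathfrak S_2(\mathcal H),\ p_\pm a|_{\mathcal H_\pm}\in\mathrm{id}+\mathfrak S_1(\mathcal H_\pm)\}$. *)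

theory Defs
  imports "HOL-Analysis.Analysis"
begin

text \<open>Complex Hilbert spaces, built on the library's complete real inner product spaces so that
  norm, topology, closures and operator norms are those of the library. The complex inner product
  is linear in its second argument; by \<open>inner_eq_Re_cinner\<close> the library norm is
  \<open>sqrt (Re (cinner x x))\<close>.\<close>

class complex_hilbert = real_inner + complete_space +
  fixes scaleC :: "complex \<Rightarrow> 'a \<Rightarrow> 'a" (infixr "*\<^sub>C" 75)
    and cinner :: "'a \<Rightarrow> 'a \<Rightarrow> complex"
  assumes scaleC_add_right: "c *\<^sub>C (x + y) = c *\<^sub>C x + c *\<^sub>C y"
    and scaleC_add_left: "(b + c) *\<^sub>C x = b *\<^sub>C x + c *\<^sub>C x"
    and scaleC_scaleC: "b *\<^sub>C c *\<^sub>C x = (b * c) *\<^sub>C x"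
    and scaleR_scaleC: "r *\<^sub>R x = complex_of_real r *\<^sub>C x"
    and cinner_add_right: "cinner x (y + z) = cinner x y + cinner x z"
    and cinner_scaleC_right: "cinner x (c *\<^sub>C y) = c * cinner x y"
    and cinner_commute: "cinner x y = cnj (cinner y x)"
    and inner_eq_Re_cinner: "inner x y = Re (cinner x y)"

lemma scaleC_one: "1 *\<^sub>C (x::'a::complex_hilbert) = x"
  using scaleR_scaleC[of 1 x] by simp

global_interpretation cvs: vector_space "scaleC :: complex \<Rightarrow> 'a \<Rightarrow> 'a::complex_hilbert"
  by standard (simp_all add: scaleC_add_right scaleC_add_left scaleC_scaleC scaleC_one)

definition infinite_dim :: "'a::complex_hilbert set \<Rightarrow> bool" where
  "infinite_dim S \<longleftrightarrow> \<not> (\<exists>B. finite B \<and> cvs.span B = S)"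

text \<open>The notions below are relative to a closed complex subspace \<open>S\<close>, regarded as a Hilbert space
  in its own right (the ambient space is \<open>S = UNIV\<close>). An operator on \<open>S\<close> is represented by a
  function on the ambient type, of which only the values on \<open>S\<close> matter.\<close>

definition bounded_op_on :: "'a::complex_hilbert set \<Rightarrow> ('a \<Rightarrow> 'a) \<Rightarrow> bool" where
  "bounded_op_on S a \<longleftrightarrow>
     a ` S \<subseteq> S \<and>
     (\<forall>x\<in>S. \<forall>y\<in>S. a (x + y) = a x + a y) \<and>
     (\<forall>c. \<forall>x\<in>S. a (c *\<^sub>C x) = c *\<^sub>C a x) \<and>
     (\<exists>K. \<forall>x\<in>S. norm (a x) \<le> K * norm x)"

definition adjoint_on :: "'a::complex_hilbert set \<Rightarrow> ('a \<Rightarrow> 'a) \<Rightarrow> ('a \<Rightarrow> 'a) \<Rightarrow> bool" where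
  "adjoint_on S a b \<longleftrightarrow>
     bounded_op_on S b \<and> (\<forall>x\<in>S. \<forall>y\<in>S. cinner (b x) y = cinner x (a y))"

definition positive_on :: "'a::complex_hilbert set \<Rightarrow> ('a \<Rightarrow> 'a) \<Rightarrow> bool" where
  "positive_on S p \<longleftrightarrow>
     bounded_op_on S p \<and> (\<forall>x\<in>S. Im (cinner x (p x)) = 0 \<and> 0 \<le> Re (cinner x (p x)))"

text \<open>\<open>p\<close> is the absolute value of \<open>a\<close>, the (unique) positive square root of \<open>b a\<close> for \<open>b\<close> the
  adjoint of \<open>a\<close>.\<close>

definition abs_op_on :: "'a::complex_hilbert set \<Rightarrow> ('a \<Rightarrow> 'a) \<Rightarrow> ('a \<Rightarrow> 'a) \<Rightarrow> bool" where
  "abs_op_on S a p \<longleftrightarrow>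
     positive_on S p \<and> (\<exists>b. adjoint_on S a b \<and> (\<forall>x\<in>S. p (p x) = b (a x)))"

definition orthonormal_basis_on :: "'a::complex_hilbert set \<Rightarrow> 'a set \<Rightarrow> bool" where
  "orthonormal_basis_on S E \<longleftrightarrow>
     (\<forall>e\<in>E. \<forall>f\<in>E. cinner e f = (if e = f then 1 else 0)) \<and> closure (cvs.span E) = S"

text \<open>Summability of the series in the next three definitions and its value do not depend on the
  orthonormal basis.\<close>

definition hilbert_schmidt_on :: "'a::complex_hilbert set \<Rightarrow> ('a \<Rightarrow> 'a) set" where
  "hilbert_schmidt_on S =
     {a. bounded_op_on S a \<and>
         (\<exists>E. orthonormal_basis_on S E \<and> (\<lambda>e. (norm (a e))\<^sup>2) summable_on E)}"

definition trace_class_on :: "'a::complex_hilbert set \<Rightarrow> ('a \<Rightarrow> 'a) set" where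
  "trace_class_on S =
     {a. bounded_op_on S a \<and>
         (\<exists>p E. abs_op_on S a p \<and> orthonormal_basis_on S E \<and>
                (\<lambda>e. Re (cinner e (p e))) summable_on E)}"

definition hs_norm :: "('a::complex_hilbert \<Rightarrow> 'a) \<Rightarrow> real" where
  "hs_norm a = sqrt (\<Sum>\<^sub>\<infinity>e\<in>(SOME E. orthonormal_basis_on UNIV E). (norm (a e))\<^sup>2)"

definition finite_rank :: "('a::complex_hilbert \<Rightarrow> 'a) set" where
  "finite_rank = {a. bounded_op_on UNIV a \<and> (\<exists>B. finite B \<and> cvs.span B = range a)}"

definition unitary_group :: "('a::complex_hilbert \<Rightarrow> 'a) set" where
  "unitary_group =
     {a. bounded_op_on UNIV a \<and>
         (\<exists>b. adjoint_on UNIV a b \<and> (\<forall>x. b (a x) = x) \<and> (\<forall>x. a (b x) = x))}"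

definition orth_proj :: "'a::complex_hilbert set \<Rightarrow> 'a \<Rightarrow> 'a" where
  "orth_proj S x = (THE y. y \<in> S \<and> (\<forall>z\<in>S. cinner z (x - y) = 0))"

definition orth_sum :: "'a::complex_hilbert set \<Rightarrow> 'a set \<Rightarrow> bool" where
  "orth_sum V W \<longleftrightarrow>
     (\<forall>v\<in>V. \<forall>w\<in>W. cinner v w = 0) \<and> (\<forall>x. \<exists>v\<in>V. \<exists>w\<in>W. x = v + w)"

lemma orth_proj_orth_sum:
  assumes "orth_sum V W" "cvs.subspace V" "v \<in> V" "w \<in> W"
  shows "orth_proj V (v + w) = v"
  unfolding orth_proj_def
proof (rule the_equality)
  show "v \<in> V \<and> (\<forall>z\<in>V. cinner z (v + w - v) = 0)"
    using assms by (auto simp: orth_sum_def)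
next
  fix y assume y: "y \<in> V \<and> (\<forall>z\<in>V. cinner z (v + w - y) = 0)"
  have mem: "v - y \<in> V"
    using assms y by (auto intro: cvs.subspace_diff)
  have "cinner (v - y) ((v - y) + w) = 0"
    using y mem by (simp add: algebra_simps)
  moreover have "cinner (v - y) w = 0"
    using assms mem by (auto simp: orth_sum_def)
  ultimately have "cinner (v - y) (v - y) = 0"
    by (simp add: cinner_add_right)
  then have "inner (v - y) (v - y) = 0"
    by (simp add: inner_eq_Re_cinner)
  then show "y = v"
    by simp
qed

definition d_op :: "'a::complex_hilbert set \<Rightarrow> 'a set \<Rightarrow> 'a \<Rightarrow> 'a" where
  "d_op Hp Hm x = \<i> *\<^sub>C (orth_proj Hp x - orth_proj Hm x)"

definition comm_op :: "('a::complex_hilbert \<Rightarrow> 'a) \<Rightarrow> ('a \<Rightarrow> 'a) \<Rightarrow> 'a \<Rightarrow> 'a" where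
  "comm_op a b x = a (b x) - b (a x)"

definition B_res :: "'a::complex_hilbert set \<Rightarrow> 'a set \<Rightarrow> ('a \<Rightarrow> 'a) set" where
  "B_res Hp Hm =
     {a. bounded_op_on UNIV a \<and> comm_op (d_op Hp Hm) a \<in> hilbert_schmidt_on UNIV}"

definition res_norm :: "'a::complex_hilbert set \<Rightarrow> 'a set \<Rightarrow> ('a \<Rightarrow> 'a) \<Rightarrow> real" where
  "res_norm Hp Hm a = onorm a + hs_norm (comm_op (d_op Hp Hm) a)"

definition U_fin :: "('a::complex_hilbert \<Rightarrow> 'a) set" where
  "U_fin = {a. (\<lambda>x. a x - x) \<in> finite_rank} \<inter> unitary_group"

definition U_12 :: "'a::complex_hilbert set \<Rightarrow> 'a set \<Rightarrow> ('a \<Rightarrow> 'a) set" where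
  "U_12 Hp Hm =
     {a \<in> unitary_group.
        (\<lambda>x. a x - x) \<in> hilbert_schmidt_on UNIV \<and>
        (\<lambda>x. orth_proj Hp (a x) - x) \<in> trace_class_on Hp \<and>
        (\<lambda>x. orth_proj Hm (a x) - x) \<in> trace_class_on Hm}"

definition U_res :: "'a::complex_hilbert set \<Rightarrow> 'a set \<Rightarrow> ('a \<Rightarrow> 'a) set" where
  "U_res Hp Hm = unitary_group \<inter> B_res Hp Hm"

definition unbounded_subset_B_res ::
    "'a::complex_hilbert set \<Rightarrow> 'a set \<Rightarrow> ('a \<Rightarrow> 'a) set \<Rightarrow> bool" where
  "unbounded_subset_B_res Hp Hm X \<longleftrightarrow>
     X \<subseteq> B_res Hp Hm \<and> \<not> (\<exists>C. \<forall>a\<in>X. res_norm Hp Hm a \<le> C)"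

end

theory Submission
  imports Defs
begin

text \<open>Take orthonormal vectors \<open>a\<^sub>1, \<dots>, a\<^sub>n\<close> of \<open>Hp\<close> and \<open>b\<^sub>1, \<dots>, b\<^sub>n\<close> of \<open>Hm\<close>. The unitary operator \<open>u\<close>
  that exchanges \<open>a\<^sub>i\<close> with \<open>b\<^sub>i\<close> and fixes the orthogonal complement of these vectors lies in all
  three groups, the diagonal blocks of \<open>u - 1\<close> being minus finite-rank projections. Since
  \<open>[d, u] a\<^sub>i = - 2 \<i> b\<^sub>i\<close>, the Hilbert-Schmidt norm of \<open>[d, u]\<close> is at least \<open>2 sqrt n\<close>.\<close>

text \<open>\<open>hs_norm\<close> is an \<open>infsum\<close> over a basis chosen by
  \<open>SOME\<close>, and \<open>infsum\<close> is 0 on a non-summable family. A lower bound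
  therefore needs summability over a basis about which nothing else is known, whereas membership in
  \<open>hilbert_schmidt_on\<close> supplies it for one basis of its own. Passing to the adjoint and
  back carries summability to every orthonormal set. The exchanged vectors need not belong to the
  chosen basis, so the values of the commutator at them do not bound the series directly. The
  adjoint form \<open>cinner (u a) (comm_op d u x) = - (2 * \<i>) * cinner a x\<close> holds for all
  \<open>x\<close>; Bessel over the vectors \<open>u a\<close> and Parseval over the basis turn it
  into the bound 4 n for the series. The factor 2 is the distance between the eigenvalues i and -i
  of \<open>d\<close>. Separability provides orthonormal bases of the whole space and of both
  halves; membership in the Hilbert-Schmidt and trace classes includes the existence of such a
  basis.\<close>

lemma cinner_add_left: "cinner (x + y) z = cinner x z + cinner y z"
  by (metis cinner_add_right cinner_commute complex_cnj_add)

lemma cinner_scaleC_left: "cinner (c *\<^sub>C x) y = cnj c * cinner x y"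
  by (metis cinner_commute cinner_scaleC_right complex_cnj_mult)

lemma cinner_minus_right: "cinner x (- y) = - cinner x y"
  by (metis add.right_neutral add_left_imp_eq cinner_add_right eq_neg_iff_add_eq_0 minus_add_cancel)

lemma cinner_minus_left: "cinner (- x) y = - cinner x y"
  by (metis cinner_commute cinner_minus_right complex_cnj_minus)

lemma cinner_diff_right: "cinner x (y - z) = cinner x y - cinner x z"
  by (metis add_uminus_conv_diff cinner_add_right cinner_minus_right)

lemma cinner_diff_left: "cinner (x - y) z = cinner x z - cinner y z"
  by (metis add_uminus_conv_diff cinner_add_left cinner_minus_left)

lemma cinner_zero_right [simp]: "cinner x 0 = 0"
  using cinner_diff_right[of x 0 0] by simp

lemma cinner_zero_left [simp]: "cinner 0 x = 0"
  using cinner_diff_left[of 0 0 x] by simp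

lemma cinner_sum_right: "cinner x (sum f A) = (\<Sum>i\<in>A. cinner x (f i))"
  by (induction A rule: infinite_finite_induct) (simp_all add: cinner_add_right)

lemma cinner_sum_left: "cinner (sum f A) x = (\<Sum>i\<in>A. cinner (f i) x)"
  by (induction A rule: infinite_finite_induct) (simp_all add: cinner_add_left)

lemmas cinner_simps = cinner_add_left cinner_add_right cinner_diff_left cinner_diff_right
  cinner_minus_left cinner_minus_right cinner_scaleC_left cinner_scaleC_right

lemma cinner_self: "cinner x x = of_real ((norm x)\<^sup>2)"
proof -
  have "Im (cinner x x) = 0"
    using arg_cong[OF cinner_commute[of x x], of Im] by simp
  then show ?thesis
    by (simp add: complex_eq_iff power2_norm_eq_inner inner_eq_Re_cinner)
qed

lemma cmod_cinner_commute: "cmod (cinner x y) = cmod (cinner y x)"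
  by (metis cinner_commute complex_mod_cnj)

lemma norm_scaleC: "norm (c *\<^sub>C x) = cmod c * norm x"
proof -
  have "complex_of_real ((norm (c *\<^sub>C x))\<^sup>2) = cinner (c *\<^sub>C x) (c *\<^sub>C x)"
    by (simp only: cinner_self)
  also have "\<dots> = (c * cnj c) * cinner x x"
    by (simp add: cinner_simps)
  also have "\<dots> = of_real ((cmod c * norm x)\<^sup>2)"
    by (simp add: cinner_self power_mult_distrib complex_norm_square[symmetric])
  finally have "complex_of_real ((norm (c *\<^sub>C x))\<^sup>2) = of_real ((cmod c * norm x)\<^sup>2)" .
  then show ?thesis
    by (metis norm_ge_zero mult_nonneg_nonneg of_real_eq_iff power2_eq_imp_eq)
qed

lemma power2_norm_add_orthogonal:
  assumes "cinner x y = 0"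
  shows "(norm (x + y))\<^sup>2 = (norm x)\<^sup>2 + (norm y)\<^sup>2"
proof -
  have "cinner y x = 0"
    using assms cinner_commute[of y x] by simp
  then have "complex_of_real ((norm (x + y))\<^sup>2) = of_real ((norm x)\<^sup>2 + (norm y)\<^sup>2)"
    using assms by (simp add: cinner_self[symmetric] cinner_simps del: of_real_power)
  then show ?thesis
    using of_real_eq_iff by blast
qed

section \<open>Orthonormal sets\<close>

text \<open>The first half of \<open>orthonormal_basis_on\<close>, split off because many of the
  sets below are not total.\<close>

definition orthonormal :: "'a::complex_hilbert set \<Rightarrow> bool" where
  "orthonormal E \<longleftrightarrow> (\<forall>e\<in>E. \<forall>f\<in>E. cinner e f = (if e = f then 1 else 0))"

text \<open>For finite orthonormal \<open>E\<close> this is the orthogonal projection onto the span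
  of \<open>E\<close>. For infinite \<open>E\<close> the \<open>sum\<close> defaults to 0.\<close>

definition fourier :: "'a::complex_hilbert set \<Rightarrow> 'a \<Rightarrow> 'a" where
  "fourier E x = (\<Sum>e\<in>E. cinner e x *\<^sub>C e)"

lemma orthonormal_subset: "orthonormal F \<Longrightarrow> E \<subseteq> F \<Longrightarrow> orthonormal E"
  unfolding orthonormal_def by blast

lemma orthonormal_norm: "orthonormal E \<Longrightarrow> e \<in> E \<Longrightarrow> norm e = 1"
  using cinner_self[of e] norm_ge_zero[of e]
  by (auto simp: orthonormal_def power2_eq_1_iff simp flip: of_real_power)

lemma fourier_in_span: "fourier E x \<in> cvs.span E"
  unfolding fourier_def by (intro cvs.span_sum cvs.span_scale cvs.span_base)

lemma cinner_fourier:
  "cinner y (fourier E x) = (\<Sum>e\<in>E. cinner y e * cinner e x)"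
  by (simp add: fourier_def cinner_sum_right cinner_scaleC_right mult.commute)

lemma cinner_fourier_left:
  "cinner (fourier E x) y = cinner x (fourier E y)"
proof -
  have "cinner (fourier E x) y = (\<Sum>e\<in>E. cnj (cinner e x) * cinner e y)"
    by (simp add: fourier_def cinner_sum_left cinner_scaleC_left)
  then show ?thesis
    by (simp add: cinner_fourier cinner_commute[symmetric])
qed

text \<open>Used for the norm of the projection in Bessel's identity, and again for its positivity
  and its trace series.\<close>

lemma cinner_fourier_self:
  "cinner x (fourier E x) = of_real (\<Sum>e\<in>E. (cmod (cinner e x))\<^sup>2)"
proof -
  have "cinner x e * cinner e x = of_real ((cmod (cinner e x))\<^sup>2)" for e
    using cinner_commute[of x e] complex_norm_square[of "cinner e x"] by (simp add: mult.commute)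
  then show ?thesis
    by (simp add: cinner_fourier)
qed

lemma cinner_basis_fourier:
  assumes "finite E" "orthonormal E" "e \<in> E"
  shows "cinner e (fourier E x) = cinner e x"
proof -
  have "cinner e (fourier E x) = (\<Sum>f\<in>E. if e = f then cinner f x else 0)"
    unfolding cinner_fourier using assms by (intro sum.cong) (auto simp: orthonormal_def)
  then show ?thesis
    using assms by simp
qed

lemma cinner_span_residual:
  assumes "finite E" "orthonormal E" "y \<in> cvs.span E"
  shows "cinner y (x - fourier E x) = 0"
  using assms(3)
  by (induction rule: cvs.span_induct_alt)
     (simp_all add: cinner_simps cinner_basis_fourier[OF assms(1,2)])

lemma fourier_fourier:
  assumes "finite E" "orthonormal E"
  shows "fourier E (fourier E x) = fourier E x"
proof -
  have "fourier E (fourier E x) = (\<Sum>e\<in>E. cinner e x *\<^sub>C e)"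
    unfolding fourier_def[of E "fourier E x"]
    by (intro sum.cong refl) (simp add: cinner_basis_fourier[OF assms])
  then show ?thesis
    by (simp add: fourier_def)
qed

text \<open>Pythagoras for a vector split into its projection and the residual. The residual is kept
  as an explicit term because Parseval has to make it small.\<close>

lemma bessel_eq:
  assumes "finite E" "orthonormal E"
  shows "(norm x)\<^sup>2 = (\<Sum>e\<in>E. (cmod (cinner e x))\<^sup>2) + (norm (x - fourier E x))\<^sup>2"
proof -
  have "cinner (fourier E x) (fourier E x) = cinner x (fourier E x)"
    by (simp add: cinner_fourier_left fourier_fourier assms)
  then have "(norm (fourier E x))\<^sup>2 = (\<Sum>e\<in>E. (cmod (cinner e x))\<^sup>2)"
    unfolding cinner_fourier_self cinner_self using of_real_eq_iff by blast
  moreover have "(norm (fourier E x + (x - fourier E x)))\<^sup>2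
      = (norm (fourier E x))\<^sup>2 + (norm (x - fourier E x))\<^sup>2"
    using assms by (intro power2_norm_add_orthogonal cinner_span_residual fourier_in_span)
  ultimately show ?thesis
    by simp
qed

lemma bessel:
  assumes "finite E" "orthonormal E"
  shows "(\<Sum>e\<in>E. (cmod (cinner e x))\<^sup>2) \<le> (norm x)\<^sup>2"
  using bessel_eq[OF assms, of x] by simp

text \<open>Pythagoras again: \<open>fourier E x - y\<close> lies in the span, to which the residual
  is orthogonal.\<close>

lemma fourier_closest:
  assumes "finite E" "orthonormal E" "y \<in> cvs.span E"
  shows "norm (x - fourier E x) \<le> norm (x - y)"
proof -
  have "cinner (fourier E x - y) (x - fourier E x) = 0"
    using assms by (intro cinner_span_residual cvs.span_diff fourier_in_span)
  from power2_norm_add_orthogonal[OF this]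
  have "(norm (x - fourier E x))\<^sup>2 \<le> (norm (x - y))\<^sup>2"
    by simp
  then show ?thesis
    by (rule power2_le_imp_le) simp
qed

lemma bessel_summable:
  assumes "orthonormal E"
  shows "(\<lambda>e. (cmod (cinner e x))\<^sup>2) summable_on E"
  using bessel orthonormal_subset[OF assms]
  by (intro nonneg_bdd_above_summable_on bdd_aboveI[where M = "(norm x)\<^sup>2"]) auto

lemma span_finite_subset:
  assumes "x \<in> cvs.span E"
  obtains F where "finite F" "F \<subseteq> E" "x \<in> cvs.span F"
proof -
  obtain t r where t: "finite t" "t \<subseteq> E" "x = (\<Sum>a\<in>t. r a *\<^sub>C a)"
    using assms unfolding cvs.span_explicit by blast
  have "x \<in> cvs.span t"
    unfolding t(3) by (intro cvs.span_sum cvs.span_scale cvs.span_base)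
  with t(1,2) show thesis
    by (rule that)
qed

text \<open>The defect of a finite partial sum is the squared distance from \<open>x\<close> to the
  span of the index set, which is small once the set contains the support of a good
  approximant.\<close>

lemma parseval:
  assumes E: "orthonormal E" and x: "x \<in> closure (cvs.span E)"
  shows "((\<lambda>e. (cmod (cinner e x))\<^sup>2) has_sum (norm x)\<^sup>2) E"
  unfolding has_sum_def
proof (rule tendstoI)
  fix r :: real assume "r > 0"
  \<comment> \<open>The radius is \<open>sqrt r\<close> because the distance enters the defect
    squared.\<close>
  then obtain y where y: "y \<in> cvs.span E" "dist y x < sqrt r"
    using x closure_approachable[of x] by (meson real_sqrt_gt_zero)
  obtain F where F: "finite F" "F \<subseteq> E" "y \<in> cvs.span F"
    using span_finite_subset[OF y(1)] .
  have "dist (\<Sum>e\<in>G. (cmod (cinner e x))\<^sup>2) ((norm x)\<^sup>2) < r"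
    if G: "finite G" "F \<subseteq> G" "G \<subseteq> E" for G
  proof -
    have on: "orthonormal G"
      using E G(3) orthonormal_subset by blast
    have "y \<in> cvs.span G"
      using F(3) G(2) cvs.span_mono by blast
    then have "norm (x - fourier G x) < sqrt r"
      using fourier_closest[OF G(1) on, of y x] y(2) by (simp add: dist_norm norm_minus_commute)
    then have "(norm (x - fourier G x))\<^sup>2 < (sqrt r)\<^sup>2"
      by (intro power_strict_mono) auto
    then show ?thesis
      using bessel_eq[OF G(1) on, of x] \<open>r > 0\<close> by (simp add: dist_real_def)
  qed
  then show "\<forall>\<^sub>F G in finite_subsets_at_top E. dist (\<Sum>e\<in>G. (cmod (cinner e x))\<^sup>2) ((norm x)\<^sup>2) < r"
    using F unfolding eventually_finite_subsets_at_top by blast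
qed

section \<open>Gram-Schmidt and the existence of orthonormal bases\<close>

text \<open>One Gram-Schmidt step: the new vector is the normalised residual of \<open>x\<close>.
  Equality of the spans keeps the new vector inside any subspace containing \<open>E\<close> and
  \<open>x\<close>, and shows that \<open>x\<close> has been absorbed.\<close>

lemma orthonormal_extend:
  assumes "finite E" "orthonormal E" "x \<notin> cvs.span E"
  obtains e where "e \<notin> E" "orthonormal (insert e E)"
    "cvs.span (insert e E) = cvs.span (insert x E)"
proof -
  define r where "r = x - fourier E x"
  define e where "e = (1 / of_real (norm r)) *\<^sub>C r"
  have "r \<noteq> 0"
    using assms(3) fourier_in_span[of E x] by (auto simp: r_def)
  have re: "r = of_real (norm r) *\<^sub>C e"
    using \<open>r \<noteq> 0\<close> by (simp add: e_def scaleC_scaleC scaleC_one)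
  have perp: "cinner f e = 0" if "f \<in> E" for f
    using cinner_span_residual[OF assms(1,2) cvs.span_base[OF that], of x]
    by (simp add: e_def r_def cinner_scaleC_right)
  have perp': "cinner e f = 0" if "f \<in> E" for f
    using perp[OF that] cinner_commute[of e f] by simp
  have "norm e = 1"
    using \<open>r \<noteq> 0\<close> by (simp add: e_def norm_scaleC norm_divide)
  then have ee: "cinner e e = 1"
    by (simp add: cinner_self)
  show thesis
  proof
    show "e \<notin> E"
      using perp ee by force
    show "orthonormal (insert e E)"
      using assms(2) perp perp' ee by (auto simp: orthonormal_def)
    have fE: "fourier E x \<in> cvs.span (insert y E)" for y
      using fourier_in_span cvs.span_mono[of E "insert y E"] by blast
    have "e \<in> cvs.span (insert x E)"
      unfolding e_def r_def by (intro cvs.span_scale cvs.span_diff fE cvs.span_base) simp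
    moreover have "x \<in> cvs.span (insert e E)"
    proof -
      have "x = of_real (norm r) *\<^sub>C e + fourier E x"
        using re by (simp add: r_def)
      also have "\<dots> \<in> cvs.span (insert e E)"
        by (intro cvs.span_add cvs.span_scale fE cvs.span_base) simp
      finally show ?thesis .
    qed
    ultimately show "cvs.span (insert e E) = cvs.span (insert x E)"
      by (simp add: cvs.span_eq cvs.span_base subset_iff)
  qed
qed

lemma orthonormal_finite_span:
  assumes "finite B"
  obtains E where "finite E" "orthonormal E" "cvs.span E = cvs.span B"
  using assms
proof (induction B arbitrary: thesis)
  case empty
  show ?case
    by (rule empty[of "{}"]) (simp_all add: orthonormal_def)
next
  case (insert x B)
  obtain E where E: "finite E" "orthonormal E" "cvs.span E = cvs.span B"
    using insert.IH .
  have span: "cvs.span (insert x E) = cvs.span (insert x B)"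
    using E(3) by (simp add: cvs.span_insert)
  show ?case
  proof (cases "x \<in> cvs.span E")
    case True
    then show ?thesis
      using insert.prems[OF E(1,2)] span cvs.span_redundant by metis
  next
    case False
    then obtain e where "orthonormal (insert e E)" "cvs.span (insert e E) = cvs.span (insert x E)"
      using orthonormal_extend[OF E(1,2)] by metis
    then show ?thesis
      using insert.prems[of "insert e E"] E(1) span by simp
  qed
qed

text \<open>No finite set spans \<open>S\<close>, so the span of \<open>n\<close> vectors misses
  some point of \<open>S\<close>, and Gram-Schmidt applied to that point adds one more
  vector.\<close>

lemma infinite_dim_orthonormal:
  assumes "cvs.subspace S" "infinite_dim S"
  shows "\<exists>A\<subseteq>S. finite A \<and> orthonormal A \<and> card A = n"
proof (induction n)
  case 0
  show ?case
    by (rule exI[of _ "{}"]) (simp add: orthonormal_def)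
next
  case (Suc n)
  then obtain A where A: "A \<subseteq> S" "finite A" "orthonormal A" "card A = n"
    by blast
  have "cvs.span A \<subseteq> S"
    using A(1) assms(1) by (simp add: cvs.span_minimal)
  then obtain x where x: "x \<in> S" "x \<notin> cvs.span A"
    using assms(2) A(2) unfolding infinite_dim_def by blast
  obtain e where e: "e \<notin> A" "orthonormal (insert e A)"
      "cvs.span (insert e A) = cvs.span (insert x A)"
    using orthonormal_extend[OF A(2,3) x(2)] .
  have "cvs.span (insert x A) \<subseteq> S"
    using A(1) x(1) assms(1) by (simp add: cvs.span_minimal)
  then have "insert e A \<subseteq> S"
    using e(3) cvs.span_superset[of "insert e A"] by blast
  then show ?case
    using e A by (intro exI[of _ "insert e A"]) simp
qed

text \<open>Gram-Schmidt along an enumeration of the dense set \<open>D\<close>; the union of the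
  increasing finite stages has a span containing \<open>D\<close>.\<close>

lemma orthonormal_basis_exists:
  assumes "cvs.subspace S" "closed S" "countable D" "D \<subseteq> S" "S \<subseteq> closure D"
  obtains E where "orthonormal_basis_on S E"
proof (cases "D = {}")
  \<comment> \<open>Impossible: 0 lies in \<open>S\<close>, but the closure of the empty set is
    empty.\<close>
  case True
  then show ?thesis
    using assms cvs.subspace_0 by fastforce
next
  case False
  define d where "d = from_nat_into D"
  have ran: "range d = D"
    unfolding d_def using range_from_nat_into[OF False assms(3)] .
  let ?P = "\<lambda>n::nat. \<lambda>E. finite E \<and> orthonormal E \<and> E \<subseteq> S"
  \<comment> \<open>Stage \<open>n\<close> absorbs the \<open>n\<close>-th point of
    \<open>D\<close>, so that point lies in the span of stage \<open>Suc n\<close>.\<close>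
  let ?Q = "\<lambda>n::nat. \<lambda>E F. E \<subseteq> F \<and> d n \<in> cvs.span F"
  have "\<exists>E. \<forall>n. ?P n (E n) \<and> ?Q n (E n) (E (Suc n))"
  proof (rule dependent_nat_choice)
    show "\<exists>E. ?P 0 E"
      by (rule exI[of _ "{}"]) (simp add: orthonormal_def)
    fix E n assume E: "?P n E"
    show "\<exists>F. ?P (Suc n) F \<and> ?Q n E F"
    proof (cases "d n \<in> cvs.span E")
      case True
      then show ?thesis using E by blast
    next
      case False
      then obtain e where e: "orthonormal (insert e E)"
          "cvs.span (insert e E) = cvs.span (insert (d n) E)"
        using orthonormal_extend E by metis
      have "cvs.span (insert (d n) E) \<subseteq> S"
        using E ran assms(1,4) by (intro cvs.span_minimal) auto
      then have "insert e E \<subseteq> S"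
        using e(2) cvs.span_superset[of "insert e E"] by blast
      moreover have "d n \<in> cvs.span (insert e E)"
        using e(2) by (simp add: cvs.span_base)
      ultimately show ?thesis
        using E e(1) by (intro exI[of _ "insert e E"]) auto
    qed
  qed
  then obtain E where E: "\<And>n. orthonormal (E n)" "\<And>n. E n \<subseteq> S" "\<And>n. E n \<subseteq> E (Suc n)"
      "\<And>n. d n \<in> cvs.span (E (Suc n))"
    by blast
  have mono: "E m \<subseteq> E n" if "m \<le> n" for m n
    using E(3) that by (rule lift_Suc_mono_le)
  define U where "U = (\<Union>n. E n)"
  have "orthonormal U"
    unfolding orthonormal_def
  proof (intro ballI)
    fix e f assume "e \<in> U" "f \<in> U"
    then obtain m n where "e \<in> E m" "f \<in> E n"
      by (auto simp: U_def)
    then have "e \<in> E (max m n)" "f \<in> E (max m n)"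
      using mono[of m "max m n"] mono[of n "max m n"] by auto
    then show "cinner e f = (if e = f then 1 else 0)"
      using E(1) unfolding orthonormal_def by blast
  qed
  moreover have "closure (cvs.span U) = S"
  proof
    have "cvs.span U \<subseteq> S"
      using E(2) assms(1) by (intro cvs.span_minimal) (auto simp: U_def)
    then show "closure (cvs.span U) \<subseteq> S"
      using assms(2) by (rule closure_minimal)
    have "D \<subseteq> cvs.span U"
    proof
      fix x assume "x \<in> D"
      then obtain n where "x = d n"
        using ran by auto
      moreover have "cvs.span (E (Suc n)) \<subseteq> cvs.span U"
        by (rule cvs.span_mono) (auto simp: U_def)
      ultimately show "x \<in> cvs.span U"
        using E(4) by blast
    qed
    then show "S \<subseteq> closure (cvs.span U)"
      using assms(5) closure_mono by blast
  qed
  ultimately show ?thesis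
    by (intro that) (auto simp: orthonormal_basis_on_def orthonormal_def)
qed

text \<open>With \<open>y\<close> itself as competitor in \<open>fourier_closest\<close>, the
  residual has norm at most 0.\<close>

lemma fourier_span:
  assumes "finite E" "orthonormal E" "y \<in> cvs.span E"
  shows "fourier E y = y"
  using fourier_closest[OF assms(1,2,3), of y] by simp

lemma fourier_orthogonal: "(\<And>e. e \<in> E \<Longrightarrow> cinner e x = 0) \<Longrightarrow> fourier E x = 0"
  by (simp add: fourier_def)

lemma fourier_add: "fourier E (x + y) = fourier E x + fourier E y"
  by (simp add: fourier_def cinner_add_right scaleC_add_left sum.distrib)

lemma fourier_scaleC: "fourier E (c *\<^sub>C x) = c *\<^sub>C fourier E x"
  by (simp add: fourier_def cinner_scaleC_right cvs.scale_sum_right scaleC_scaleC)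

lemma norm_fourier_le:
  assumes "finite E" "orthonormal E"
  shows "norm (fourier E x) \<le> norm x"
proof -
  have "cinner (fourier E x) (x - fourier E x) = 0"
    using assms by (intro cinner_span_residual fourier_in_span)
  from power2_norm_add_orthogonal[OF this] have "(norm (fourier E x))\<^sup>2 \<le> (norm x)\<^sup>2"
    by simp
  then show ?thesis
    by (rule power2_le_imp_le) simp
qed

section \<open>Bounded operators and adjoints\<close>

lemma bounded_op_onI:
  assumes "\<And>x. x \<in> S \<Longrightarrow> a x \<in> S"
    and "\<And>x y. x \<in> S \<Longrightarrow> y \<in> S \<Longrightarrow> a (x + y) = a x + a y"
    and "\<And>c x. x \<in> S \<Longrightarrow> a (c *\<^sub>C x) = c *\<^sub>C a x"
    and "\<And>x. x \<in> S \<Longrightarrow> norm (a x) \<le> K * norm x"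
  shows "bounded_op_on S a"
  using assms unfolding bounded_op_on_def by blast

lemma bounded_op_add: "bounded_op_on UNIV a \<Longrightarrow> a (x + y) = a x + a y"
  by (simp add: bounded_op_on_def)

lemma bounded_op_scaleC: "bounded_op_on UNIV a \<Longrightarrow> a (c *\<^sub>C x) = c *\<^sub>C a x"
  by (simp add: bounded_op_on_def)

lemma bounded_op_zero: "bounded_op_on UNIV a \<Longrightarrow> a 0 = 0"
  using bounded_op_scaleC[of a 0 0] by simp

lemma bounded_op_sum:
  "bounded_op_on UNIV a \<Longrightarrow> a (sum f A) = (\<Sum>i\<in>A. a (f i))"
  by (induction A rule: infinite_finite_induct) (simp_all add: bounded_op_zero bounded_op_add)

lemma bounded_op_bound:
  assumes "bounded_op_on UNIV a"
  obtains K where "K \<ge> 0" "\<And>x. norm (a x) \<le> K * norm x"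
proof -
  obtain K where "\<And>x. norm (a x) \<le> K * norm x"
    using assms by (auto simp: bounded_op_on_def)
  moreover have "K * norm x \<le> \<bar>K\<bar> * norm x" for x :: 'a
    by (intro mult_right_mono) auto
  ultimately show thesis
    by (intro that[of "\<bar>K\<bar>"]) (auto intro: order_trans)
qed

lemma bounded_op_bounded_linear:
  assumes "bounded_op_on UNIV a"
  shows "bounded_linear a"
proof -
  obtain K where "\<And>x. norm (a x) \<le> K * norm x"
    using bounded_op_bound[OF assms] by blast
  then show ?thesis
    by (intro bounded_linear_intro[where K = K])
       (simp_all add: bounded_op_add[OF assms] bounded_op_scaleC[OF assms] scaleR_scaleC mult.commute)
qed

lemma bounded_op_diff:
  assumes "bounded_op_on UNIV a" "bounded_op_on UNIV b"
  shows "bounded_op_on UNIV (\<lambda>x. a x - b x)"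
proof -
  obtain K where K: "\<And>x. norm (a x) \<le> K * norm x"
    using bounded_op_bound[OF assms(1)] by blast
  obtain L where L: "\<And>x. norm (b x) \<le> L * norm x"
    using bounded_op_bound[OF assms(2)] by blast
  have "norm (a x - b x) \<le> (K + L) * norm x" for x
    using norm_triangle_ineq4[of "a x" "b x"] K[of x] L[of x] by (simp add: distrib_right)
  then show ?thesis
    using assms
    by (intro bounded_op_onI)
       (simp_all add: bounded_op_add bounded_op_scaleC cvs.scale_right_diff_distrib)
qed

lemma bounded_op_compose:
  assumes "bounded_op_on UNIV a" "bounded_op_on UNIV b"
  shows "bounded_op_on UNIV (\<lambda>x. a (b x))"
proof -
  obtain K where K: "K \<ge> 0" "\<And>x. norm (a x) \<le> K * norm x"
    using bounded_op_bound[OF assms(1)] by blast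
  obtain L where L: "\<And>x. norm (b x) \<le> L * norm x"
    using bounded_op_bound[OF assms(2)] by blast
  have "norm (a (b x)) \<le> (K * L) * norm x" for x
    using K(2)[of "b x"] mult_left_mono[OF L[of x] K(1)] by (simp add: mult.assoc)
  then show ?thesis
    using assms by (intro bounded_op_onI) (simp_all add: bounded_op_add bounded_op_scaleC)
qed

lemma bounded_op_id: "bounded_op_on UNIV (\<lambda>x. x)"
  by (rule bounded_op_onI[where K = 1]) simp_all

lemma bounded_op_fourier:
  assumes "finite E" "orthonormal E" "E \<subseteq> S" "cvs.subspace S"
  shows "bounded_op_on S (fourier E)"
proof (rule bounded_op_onI[where K = 1])
  show "fourier E x \<in> S" for x
    using fourier_in_span cvs.span_minimal[OF assms(3,4)] by blast
qed (simp_all add: fourier_add fourier_scaleC norm_fourier_le assms)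

lemma adjoint_on_sym:
  assumes "bounded_op_on S a" "adjoint_on S a b"
  shows "adjoint_on S b a"
  unfolding adjoint_on_def
proof (intro conjI ballI assms(1))
  fix x y assume "x \<in> S" "y \<in> S"
  then have "cnj (cinner y (a x)) = cnj (cinner (b y) x)"
    using assms(2) by (simp add: adjoint_on_def)
  then show "cinner (a x) y = cinner x (b y)"
    by (simp flip: cinner_commute)
qed

lemma adjoint_diff_id:
  "adjoint_on UNIV a b \<Longrightarrow> adjoint_on UNIV (\<lambda>x. a x - x) (\<lambda>x. b x - x)"
  by (simp add: adjoint_on_def bounded_op_diff bounded_op_id cinner_simps)

lemma unitary_cinner:
  assumes "u \<in> unitary_group"
  shows "cinner (u x) (u y) = cinner x y"
proof -
  obtain b where "\<And>x y. cinner (b x) y = cinner x (u y)" "\<And>x. b (u x) = x"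
    using assms by (auto simp: unitary_group_def adjoint_on_def)
  then show ?thesis
    by metis
qed

section \<open>Hilbert-Schmidt and trace class operators\<close>

lemma has_sum_finite_sum:
  fixes f :: "'b \<Rightarrow> 'c \<Rightarrow> real"
  assumes "finite A" "\<And>a. a \<in> A \<Longrightarrow> (f a has_sum s a) B"
  shows "((\<lambda>x. \<Sum>a\<in>A. f a x) has_sum sum s A) B"
  using assms by (induction A) (auto intro!: has_sum_add has_sum_0)

lemma bessel_summable_sum:
  assumes "finite A" "orthonormal E"
  shows "(\<lambda>e. \<Sum>a\<in>A. (cmod (cinner e (f a)))\<^sup>2) summable_on E"
  using assms by (induction A) (auto intro!: summable_on_add bessel_summable)

text \<open>Parseval in \<open>E\<close> and Bessel in \<open>F\<close> for the matrix entries \<open>cinner f (a e)\<close>: only finitely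
  many \<open>f\<close> are summed at a time, so no interchange of infinite sums is needed.\<close>

lemma summable_adjoint:
  assumes E: "orthonormal_basis_on UNIV E" and F: "orthonormal F"
    and adj: "adjoint_on UNIV a b" and sum: "(\<lambda>e. (norm (a e))\<^sup>2) summable_on E"
  shows "(\<lambda>f. (norm (b f))\<^sup>2) summable_on F"
proof (intro nonneg_bdd_above_summable_on bdd_aboveI)
  fix s assume "s \<in> sum (\<lambda>f. (norm (b f))\<^sup>2) ` {G. G \<subseteq> F \<and> finite G}"
  then obtain G where G: "G \<subseteq> F" "finite G" and s: "s = (\<Sum>f\<in>G. (norm (b f))\<^sup>2)"
    by auto
  have onE: "orthonormal E" and clE: "closure (cvs.span E) = UNIV"
    using E by (auto simp: orthonormal_basis_on_def orthonormal_def)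
  have swap: "cmod (cinner e (b f)) = cmod (cinner f (a e))" for e f
    using adj cmod_cinner_commute[of e "b f"] by (simp add: adjoint_on_def)
  have "((\<lambda>e. \<Sum>f\<in>G. (cmod (cinner f (a e)))\<^sup>2) has_sum s) E"
    unfolding s swap[symmetric]
    by (intro has_sum_finite_sum G(2) parseval onE) (simp add: clE)
  moreover have "((\<lambda>e. (norm (a e))\<^sup>2) has_sum (\<Sum>\<^sub>\<infinity>e\<in>E. (norm (a e))\<^sup>2)) E"
    using sum by (rule has_sum_infsum)
  ultimately show "s \<le> (\<Sum>\<^sub>\<infinity>e\<in>E. (norm (a e))\<^sup>2)"
    by (rule has_sum_mono) (rule bessel[OF G(2) orthonormal_subset[OF F G(1)]])
qed simp

text \<open>\<open>summable_adjoint\<close> is applied twice: from \<open>a\<close> to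
  \<open>b\<close> over the given basis, then from \<open>b\<close> back to \<open>a\<close> over
  \<open>F\<close>. The set \<open>F\<close> may be any orthonormal set.\<close>

lemma hilbert_schmidt_summable:
  assumes "a \<in> hilbert_schmidt_on UNIV" "adjoint_on UNIV a b" "orthonormal F"
  shows "(\<lambda>f. (norm (a f))\<^sup>2) summable_on F"
proof -
  obtain E where E: "orthonormal_basis_on UNIV E" "(\<lambda>e. (norm (a e))\<^sup>2) summable_on E"
    using assms(1) by (auto simp: hilbert_schmidt_on_def)
  have "orthonormal E"
    using E(1) by (simp add: orthonormal_basis_on_def orthonormal_def)
  then have b: "(\<lambda>e. (norm (b e))\<^sup>2) summable_on E"
    by (rule summable_adjoint[OF E(1) _ assms(2) E(2)])
  have "bounded_op_on UNIV a"
    using assms(1) by (simp add: hilbert_schmidt_on_def)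
  then have "adjoint_on UNIV b a"
    using assms(2) by (rule adjoint_on_sym)
  then show ?thesis
    using b by (rule summable_adjoint[OF E(1) assms(3)])
qed

text \<open>An orthonormal frame \<open>G\<close> of the range turns the squared norm of
  \<open>a e\<close> into finitely many terms \<open>cinner e (b g)\<close>, each summable over
  \<open>e\<close> by Bessel.\<close>

lemma finite_rank_hilbert_schmidt:
  fixes E :: "'a::complex_hilbert set" and a :: "'a \<Rightarrow> 'a"
  assumes a: "a \<in> finite_rank" "adjoint_on UNIV a b" and E: "orthonormal_basis_on UNIV E"
  shows "a \<in> hilbert_schmidt_on UNIV"
proof -
  obtain B where B: "finite B" "cvs.span B = range a"
    using a(1) by (auto simp: finite_rank_def)
  obtain G where G: "finite G" "orthonormal G" "cvs.span G = range a"
    using orthonormal_finite_span[OF B(1)] unfolding B(2) .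
  have "(norm (a e))\<^sup>2 = (\<Sum>g\<in>G. (cmod (cinner e (b g)))\<^sup>2)" for e
  proof -
    have "fourier G (a e) = a e"
      using G by (intro fourier_span) auto
    moreover have "cmod (cinner g (a e)) = cmod (cinner e (b g))" for g
      using a(2) cmod_cinner_commute[of e "b g"] by (simp add: adjoint_on_def)
    ultimately show ?thesis
      using bessel_eq[OF G(1,2), of "a e"] by simp
  qed
  moreover have "orthonormal E"
    using E by (simp add: orthonormal_basis_on_def orthonormal_def)
  then have "(\<lambda>e. \<Sum>g\<in>G. (cmod (cinner e (b g)))\<^sup>2) summable_on E"
    by (rule bessel_summable_sum[OF G(1)])
  ultimately have "(\<lambda>e. (norm (a e))\<^sup>2) summable_on E"
    by simp
  then show ?thesis
    using a(1) E by (auto simp: hilbert_schmidt_on_def finite_rank_def)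
qed

text \<open>The absolute value of \<open>- P\<close>, for an orthogonal projection \<open>P\<close>, is \<open>P\<close> itself.\<close>

lemma trace_class_minus_fourier:
  assumes A: "finite A" "orthonormal A" "A \<subseteq> S" and S: "cvs.subspace S"
    and E: "orthonormal_basis_on S E" and c: "\<And>x. x \<in> S \<Longrightarrow> c x = - fourier A x"
  shows "c \<in> trace_class_on S"
proof -
  have P: "bounded_op_on S (fourier A)"
    using A S by (rule bounded_op_fourier)
  have mP: "bounded_op_on S (\<lambda>x. - fourier A x)"
    using P S by (auto simp: bounded_op_on_def cvs.subspace_neg image_subset_iff)
  have cb: "bounded_op_on S c"
    using mP c S by (simp add: bounded_op_on_def cvs.subspace_add cvs.subspace_scale)
  have PS: "fourier A x \<in> S" if "x \<in> S" for x
    using P that by (auto simp: bounded_op_on_def)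
  have adj: "adjoint_on S c (\<lambda>x. - fourier A x)"
    using mP c by (simp add: adjoint_on_def cinner_simps cinner_fourier_left)
  have "fourier A (fourier A x) = - fourier A (c x)" if "x \<in> S" for x
    using c that fourier_scaleC[of A "-1" "fourier A x"] by (simp add: cvs.scale_minus_left scaleC_one)
  then have "abs_op_on S c (fourier A)"
    using P adj unfolding abs_op_on_def positive_on_def
    by (auto simp: cinner_fourier_self sum_nonneg)
  moreover have "orthonormal E"
    using E by (simp add: orthonormal_basis_on_def orthonormal_def)
  \<comment> \<open>The trace series of the projection is a sum of finitely many Bessel series, one
    for each vector of \<open>A\<close>.\<close>
  then have "(\<lambda>e. \<Sum>a\<in>A. (cmod (cinner e a))\<^sup>2) summable_on E"
    by (rule bessel_summable_sum[OF A(1)])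
  then have "(\<lambda>e. Re (cinner e (fourier A e))) summable_on E"
    unfolding cinner_fourier_self by (simp add: cmod_cinner_commute)
  ultimately show ?thesis
    using cb E unfolding trace_class_on_def by blast
qed

section \<open>Orthogonal decompositions\<close>

lemma orth_sum_sym: "orth_sum V W \<Longrightarrow> orth_sum W V"
  unfolding orth_sum_def
proof (intro conjI ballI allI; elim conjE)
  fix w v assume "w \<in> W" "v \<in> V" "\<forall>v\<in>V. \<forall>w\<in>W. cinner v w = 0"
  then show "cinner w v = 0"
    using cinner_commute[of w v] by simp
next
  fix x assume "\<forall>x. \<exists>v\<in>V. \<exists>w\<in>W. x = v + w"
  then obtain v w where "v \<in> V" "w \<in> W" "x = v + w"
    by blast
  then show "\<exists>w\<in>W. \<exists>v\<in>V. x = w + v"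
    by (intro bexI[of _ w] bexI[of _ v]) (simp_all add: add.commute)
qed

text \<open>Separability passes to \<open>V\<close>: projecting a point onto \<open>V\<close> does
  not increase its distance to points of \<open>V\<close>, so the projection of a dense set is dense
  in \<open>V\<close>.\<close>

lemma orth_sum_basis_exists:
  fixes V W :: "'a::complex_hilbert set"
  assumes sep: "separable_space (euclidean :: 'a topology)"
    and V: "cvs.subspace V" "closed V" and VW: "orth_sum V W" and W: "cvs.subspace W"
  obtains E where "orthonormal_basis_on V E"
proof -
  obtain D :: "'a set" where D: "countable D" "closure D = UNIV"
    using sep by (auto simp: separable_space_def)
  have mem: "orth_proj V x \<in> V" for x
  proof -
    obtain v w where "v \<in> V" "w \<in> W" "x = v + w"
      using VW unfolding orth_sum_def by blast
    then show ?thesis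
      using orth_proj_orth_sum[OF VW V(1)] by simp
  qed
  have "x \<in> closure (orth_proj V ` D)" if "x \<in> V" for x
    unfolding closure_approachable
  proof (intro allI impI)
    fix r :: real assume "r > 0"
    then obtain y where y: "y \<in> D" "dist y x < r"
      using D(2) closure_approachable[of x D] by auto
    obtain v w where vw: "v \<in> V" "w \<in> W" "y = v + w"
      using VW unfolding orth_sum_def by blast
    \<comment> \<open>\<open>y - x\<close> is the orthogonal sum of \<open>v - x\<close> and
      \<open>w\<close>.\<close>
    have "cinner (v - x) w = 0"
      using VW vw that V(1) by (auto simp: orth_sum_def intro: cvs.subspace_diff)
    from power2_norm_add_orthogonal[OF this]
    have "(norm (v - x))\<^sup>2 \<le> (norm (y - x))\<^sup>2"
      by (simp add: vw(3) algebra_simps)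
    then have "norm (v - x) \<le> norm (y - x)"
      by (rule power2_le_imp_le) simp
    moreover have "orth_proj V y = v"
      using vw VW V(1) by (simp add: orth_proj_orth_sum)
    ultimately show "\<exists>z\<in>orth_proj V ` D. dist z x < r"
      using y by (intro bexI[of _ v]) (auto simp: dist_norm)
  qed
  then show thesis
    using orthonormal_basis_exists[OF V countable_image[OF D(1)]] mem that by blast
qed

text \<open>The residual of \<open>x\<close> is fixed by \<open>u\<close>, while the part of
  \<open>x\<close> in the span of \<open>A\<close> is sent into \<open>W\<close> and killed by the
  projection. The roles of \<open>V\<close> and \<open>W\<close> are left open so that both diagonal
  blocks are instances.\<close>

lemma orth_proj_swap:
  assumes VW: "orth_sum V W" "cvs.subspace V" "cvs.subspace W"
    and A: "finite A" "orthonormal A" "A \<subseteq> V"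
    and u: "bounded_op_on UNIV u" "\<And>a. a \<in> A \<Longrightarrow> u a \<in> W"
    and fix_u: "\<And>r. r \<in> V \<Longrightarrow> (\<And>a. a \<in> A \<Longrightarrow> cinner a r = 0) \<Longrightarrow> u r = r"
    and x: "x \<in> V"
  shows "orth_proj V (u x) - x = - fourier A x"
proof -
  let ?r = "x - fourier A x"
  have r: "?r \<in> V"
    using fourier_in_span cvs.span_minimal[OF A(3) VW(2)] x VW(2) by (blast intro: cvs.subspace_diff)
  have "u x = u ?r + u (fourier A x)"
    using bounded_op_add[OF u(1), of ?r "fourier A x"] by simp
  also have "u ?r = ?r"
    using cinner_span_residual[OF A(1,2)] by (intro fix_u r) (simp add: cvs.span_base)
  also have "u (fourier A x) = (\<Sum>a\<in>A. cinner a x *\<^sub>C u a)"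
    unfolding fourier_def by (simp add: bounded_op_sum[OF u(1)] bounded_op_scaleC[OF u(1)])
  finally have "u x = ?r + (\<Sum>a\<in>A. cinner a x *\<^sub>C u a)" .
  moreover have "(\<Sum>a\<in>A. cinner a x *\<^sub>C u a) \<in> W"
    using u(2) VW(3) by (intro cvs.subspace_sum cvs.subspace_scale)
  ultimately show ?thesis
    using orth_proj_orth_sum[OF VW(1,2) r] by simp
qed

section \<open>The operator \<open>d\<close> and the commutators \<open>[d, u]\<close>\<close>

locale polarization =
  fixes Hp Hm :: "'a::complex_hilbert set"
  assumes subspace_p: "cvs.subspace Hp" and subspace_m: "cvs.subspace Hm"
    and orth: "orth_sum Hp Hm"
begin

abbreviation d :: "'a \<Rightarrow> 'a" where "d \<equiv> d_op Hp Hm"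

lemma decompose:
  obtains v w where "v \<in> Hp" "w \<in> Hm" "x = v + w"
  using orth unfolding orth_sum_def by blast

lemma cinner_pm: "v \<in> Hp \<Longrightarrow> w \<in> Hm \<Longrightarrow> cinner v w = 0"
  and cinner_mp: "v \<in> Hp \<Longrightarrow> w \<in> Hm \<Longrightarrow> cinner w v = 0"
  using orth orth_sum_sym[OF orth] by (auto simp: orth_sum_def)

lemma d_eq:
  assumes "v \<in> Hp" "w \<in> Hm"
  shows "d (v + w) = \<i> *\<^sub>C (v - w)"
  using orth_proj_orth_sum[OF orth subspace_p assms]
    orth_proj_orth_sum[OF orth_sum_sym[OF orth] subspace_m assms(2,1)]
  by (simp add: d_op_def add.commute)

lemma d_p: "v \<in> Hp \<Longrightarrow> d v = \<i> *\<^sub>C v"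
  and d_m: "w \<in> Hm \<Longrightarrow> d w = - (\<i> *\<^sub>C w)"
  using d_eq[of v 0] d_eq[of 0 w] subspace_p subspace_m cvs.subspace_0
  by (auto simp: cvs.scale_minus_right)

lemma cinner_d_d: "cinner (d x) (d y) = cinner x y"
proof -
  obtain v w where x: "v \<in> Hp" "w \<in> Hm" "x = v + w" using decompose .
  obtain v' w' where y: "v' \<in> Hp" "w' \<in> Hm" "y = v' + w'" using decompose .
  show ?thesis
    using x y by (simp add: d_eq cinner_simps cinner_pm cinner_mp algebra_simps)
qed

text \<open>Skew-adjointness moves \<open>d\<close> to the left argument, where it acts on
  eigenvectors.\<close>

lemma cinner_d_right: "cinner x (d y) = - cinner (d x) y"
proof -
  obtain v w where x: "v \<in> Hp" "w \<in> Hm" "x = v + w" using decompose .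
  obtain v' w' where y: "v' \<in> Hp" "w' \<in> Hm" "y = v' + w'" using decompose .
  show ?thesis
    using x y by (simp add: d_eq cinner_simps cinner_pm cinner_mp algebra_simps)
qed

lemma norm_d: "norm (d x) = norm x"
  using cinner_d_d[of x x] unfolding cinner_self
  by (metis norm_ge_zero of_real_eq_iff power2_eq_imp_eq)

lemma bounded_op_d: "bounded_op_on UNIV d"
proof (rule bounded_op_onI[where K = 1])
  fix x y :: 'a and c :: complex
  obtain v w where x: "v \<in> Hp" "w \<in> Hm" "x = v + w" using decompose .
  obtain v' w' where y: "v' \<in> Hp" "w' \<in> Hm" "y = v' + w'" using decompose .
  have "x + y = (v + v') + (w + w')"
    by (simp add: x y)
  then have "d (x + y) = \<i> *\<^sub>C ((v + v') - (w + w'))"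
    using x y d_eq cvs.subspace_add[OF subspace_p] cvs.subspace_add[OF subspace_m] by metis
  then show "d (x + y) = d x + d y"
    using x y by (simp add: d_eq scaleC_add_right[symmetric])
  have "c *\<^sub>C x = c *\<^sub>C v + c *\<^sub>C w"
    by (simp add: x scaleC_add_right)
  then have "d (c *\<^sub>C x) = \<i> *\<^sub>C (c *\<^sub>C v - c *\<^sub>C w)"
    using x d_eq cvs.subspace_scale[OF subspace_p] cvs.subspace_scale[OF subspace_m] by metis
  then show "d (c *\<^sub>C x) = c *\<^sub>C d x"
    using x by (simp add: d_eq cvs.scale_right_diff_distrib scaleC_scaleC mult.commute)
qed (simp_all add: norm_d)

text \<open>Since \<open>d\<close> preserves inner products, Hilbert-Schmidt sums may be taken over
  the image of \<open>F\<close> and reindexed by \<open>F\<close>.\<close>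

lemma orthonormal_d:
  assumes "orthonormal F"
  shows "orthonormal (d ` F)" "inj_on d F"
proof -
  have "d e = d f \<longleftrightarrow> e = f" if "e \<in> F" "f \<in> F" for e f
    using assms that cinner_d_d[of e f] cinner_d_d[of e e] unfolding orthonormal_def
    by (metis zero_neq_one)
  then show "inj_on d F" "orthonormal (d ` F)"
    using assms by (auto simp: inj_on_def orthonormal_def cinner_d_d)
qed

text \<open>The identity commutes with \<open>d\<close>, so \<open>[d, u]\<close> is the commutator
  of \<open>d\<close> with \<open>u - 1\<close>. As \<open>d\<close> is isometric, its two terms
  have the norms of \<open>u - 1\<close> on \<open>F\<close> and on the image of \<open>F\<close>
  under \<open>d\<close>.\<close>

lemma comm_summable:
  assumes u: "u \<in> unitary_group" and hs: "(\<lambda>x. u x - x) \<in> hilbert_schmidt_on UNIV"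
    and F: "orthonormal F"
  shows "(\<lambda>f. (norm (comm_op d u f))\<^sup>2) summable_on F"
proof -
  let ?a = "\<lambda>x. u x - x"
  obtain b where "adjoint_on UNIV ?a b"
    using u adjoint_diff_id by (auto simp: unitary_group_def)
  note summable = hilbert_schmidt_summable[OF hs this]
  have "(\<lambda>f. (norm (?a (d f)))\<^sup>2) summable_on F"
    using summable[OF orthonormal_d(1)[OF F]]
      summable_on_reindex[OF orthonormal_d(2)[OF F], of "\<lambda>f. (norm (?a f))\<^sup>2"]
    by (simp add: o_def)
  \<comment> \<open>The majorant comes from \<open>(p + q)^2 <= 2 (p^2 + q^2)\<close>.\<close>
  then have "(\<lambda>f. 2 * ((norm (?a f))\<^sup>2 + (norm (?a (d f)))\<^sup>2)) summable_on F"
    using summable[OF F] by (intro summable_on_cmult_right summable_on_add)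
  then show ?thesis
  proof (rule summable_on_comparison_test)
    fix f
    have "d (u f) = d (?a f) + d f"
      by (simp add: bounded_op_add[OF bounded_op_d, symmetric])
    then have "comm_op d u f = d (?a f) - ?a (d f)"
      by (simp add: comm_op_def)
    then have "norm (comm_op d u f) \<le> norm (?a f) + norm (?a (d f))"
      using norm_triangle_ineq4[of "d (?a f)" "?a (d f)"] by (simp add: norm_d)
    then have "(norm (comm_op d u f))\<^sup>2 \<le> (norm (?a f) + norm (?a (d f)))\<^sup>2"
      by (intro power_mono) auto
    also have "\<dots> \<le> 2 * ((norm (?a f))\<^sup>2 + (norm (?a (d f)))\<^sup>2)"
      using zero_le_power2[of "norm (?a f) - norm (?a (d f))"]
      by (simp add: power2_eq_square algebra_simps)
    finally show "(norm (comm_op d u f))\<^sup>2 \<le> 2 * ((norm (?a f))\<^sup>2 + (norm (?a (d f)))\<^sup>2)" .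
  qed simp
qed

lemma unitary_in_B_res:
  assumes u: "u \<in> unitary_group" and hs: "(\<lambda>x. u x - x) \<in> hilbert_schmidt_on UNIV"
  shows "u \<in> B_res Hp Hm"
proof -
  obtain E :: "'a set" where E: "orthonormal_basis_on UNIV E"
    using hs by (auto simp: hilbert_schmidt_on_def)
  then have "orthonormal E"
    by (simp add: orthonormal_basis_on_def orthonormal_def)
  moreover have ub: "bounded_op_on UNIV u"
    using u by (simp add: unitary_group_def)
  have "bounded_op_on UNIV (comm_op d u)"
    unfolding comm_op_def[abs_def]
    by (rule bounded_op_diff[OF bounded_op_compose[OF bounded_op_d ub]
          bounded_op_compose[OF ub bounded_op_d]])
  ultimately have "comm_op d u \<in> hilbert_schmidt_on UNIV"
    using comm_summable[OF u hs] E unfolding hilbert_schmidt_on_def by blast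
  with ub show ?thesis
    by (simp add: B_res_def)
qed

text \<open>Each basis vector contributes at least the squared length of the component of its image
  along the vectors \<open>u a\<close>. By Parseval these contributions add up to 4 for each
  \<open>a\<close>, whatever the basis.\<close>

lemma hs_norm_comm_ge:
  assumes u: "u \<in> unitary_group" and hs: "(\<lambda>x. u x - x) \<in> hilbert_schmidt_on UNIV"
    and A: "finite A" "orthonormal A" "A \<subseteq> Hp" and B: "orthonormal (u ` A)" "u ` A \<subseteq> Hm"
  shows "2 * sqrt (card A) \<le> hs_norm (comm_op d u)"
proof -
  define E :: "'a set" where "E = (SOME E. orthonormal_basis_on UNIV E)"
  have "\<exists>E :: 'a set. orthonormal_basis_on UNIV E"
    using hs by (auto simp: hilbert_schmidt_on_def)
  then have "orthonormal_basis_on UNIV E"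
    unfolding E_def by (rule someI_ex)
  then have E: "orthonormal E" "closure (cvs.span E) = UNIV"
    by (auto simp: orthonormal_basis_on_def orthonormal_def)
  have inj: "inj_on u A"
  proof (rule inj_onI)
    fix a b assume "a \<in> A" "b \<in> A" "u a = u b"
    then show "a = b"
      using A(2) unitary_cinner[OF u, of a b] unitary_cinner[OF u, of a a]
      unfolding orthonormal_def by (metis zero_neq_one)
  qed
  \<comment> \<open>\<open>a\<close> and \<open>u a\<close> are eigenvectors of \<open>d\<close> for
    i and -i, so both terms of the commutator are multiples of \<open>cinner a x\<close>, with
    factors i and -i, and they reinforce each other.\<close>
  have entry: "cinner (u a) (comm_op d u x) = - (2 * \<i>) * cinner a x" if "a \<in> A" for a x
  proof -
    have da: "d a = \<i> *\<^sub>C a" "d (u a) = - (\<i> *\<^sub>C u a)"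
      using that A(3) B(2) d_p d_m by auto
    have "cinner (u a) (d (u x)) = - \<i> * cinner a x"
      by (simp add: cinner_d_right da cinner_simps unitary_cinner[OF u])
    moreover have "cinner (u a) (u (d x)) = \<i> * cinner a x"
      by (simp add: unitary_cinner[OF u] cinner_d_right da cinner_simps)
    ultimately show ?thesis
      by (simp add: comm_op_def cinner_simps)
  qed
  have "((\<lambda>e. \<Sum>a\<in>A. (cmod (cinner e a))\<^sup>2) has_sum (\<Sum>a\<in>A. (norm a)\<^sup>2)) E"
    by (intro has_sum_finite_sum A(1) parseval E(1)) (simp add: E(2))
  moreover have "(\<Sum>a\<in>A. (norm a)\<^sup>2) = card A"
    using orthonormal_norm[OF A(2)] by simp
  ultimately have "((\<lambda>e. 4 * (\<Sum>a\<in>A. (cmod (cinner e a))\<^sup>2)) has_sum 4 * real (card A)) E"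
    by (intro has_sum_cmult_right) simp
  \<comment> \<open>Summability is essential here: without it the \<open>infsum\<close> would be 0
    by default.\<close>
  moreover have "((\<lambda>e. (norm (comm_op d u e))\<^sup>2) has_sum (\<Sum>\<^sub>\<infinity>e\<in>E. (norm (comm_op d u e))\<^sup>2)) E"
    using comm_summable[OF u hs E(1)] by (rule has_sum_infsum)
  ultimately have "4 * real (card A) \<le> (\<Sum>\<^sub>\<infinity>e\<in>E. (norm (comm_op d u e))\<^sup>2)"
  proof (rule has_sum_mono)
    fix e
    have "(\<Sum>k\<in>u ` A. (cmod (cinner k (comm_op d u e)))\<^sup>2) \<le> (norm (comm_op d u e))\<^sup>2"
      using bessel[OF finite_imageI[OF A(1)] B(1)] .
    moreover have "(\<Sum>k\<in>u ` A. (cmod (cinner k (comm_op d u e)))\<^sup>2)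
        = 4 * (\<Sum>a\<in>A. (cmod (cinner e a))\<^sup>2)"
      using inj by (simp add: sum.reindex entry norm_mult power_mult_distrib sum_distrib_left
          cmod_cinner_commute[of e])
    ultimately show "4 * (\<Sum>a\<in>A. (cmod (cinner e a))\<^sup>2) \<le> (norm (comm_op d u e))\<^sup>2"
      by simp
  qed
  then have "sqrt (4 * real (card A)) \<le> hs_norm (comm_op d u)"
    unfolding hs_norm_def E_def[symmetric] by simp
  then show ?thesis
    by (simp add: real_sqrt_mult)
qed

end

section \<open>The unitary operators exchanging orthonormal sets\<close>

text \<open>The projection \<open>fourier G\<close> is a self-adjoint idempotent, so this reflection
  is self-adjoint and its own inverse, hence unitary. It differs from the identity by -2 times the
  projection, whose range is the span of \<open>G\<close>.\<close>

lemma reflection_U_fin: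
  assumes G: "finite G" "orthonormal G"
  shows "(\<lambda>x. x - 2 *\<^sub>C fourier G x) \<in> U_fin"
proof -
  let ?u = "\<lambda>x. x - 2 *\<^sub>C fourier G x"
  have P: "bounded_op_on UNIV (fourier G)"
    using bounded_op_fourier[OF G] by simp
  have P2: "bounded_op_on UNIV (\<lambda>x. c *\<^sub>C fourier G x)" for c
    by (rule bounded_op_onI[where K = "cmod c"])
      (simp_all add: fourier_add fourier_scaleC scaleC_add_right scaleC_scaleC mult.commute[of c]
        norm_scaleC mult_left_mono norm_fourier_le G)
  have u: "bounded_op_on UNIV ?u"
    by (intro bounded_op_diff bounded_op_id P2)
  have adj: "adjoint_on UNIV ?u ?u"
    using u by (simp add: adjoint_on_def cinner_simps cinner_fourier_left)
  have inv: "?u (?u x) = x" for x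
  proof -
    have "fourier G (?u x) = fourier G x - 2 *\<^sub>C fourier G x"
      using fourier_add[of G "?u x" "2 *\<^sub>C fourier G x"]
      by (simp add: fourier_scaleC fourier_fourier[OF G] algebra_simps)
    also have "\<dots> = - fourier G x"
      using scaleC_add_left[of 1 1 "fourier G x"] by (simp add: scaleC_one)
    finally show ?thesis
      by (simp add: cvs.scale_minus_right)
  qed
  have diff: "(\<lambda>x. ?u x - x) = (\<lambda>x. (- 2) *\<^sub>C fourier G x)"
    by (simp add: cvs.scale_minus_left)
  have "range (\<lambda>x. (- 2) *\<^sub>C fourier G x) = cvs.span G"
  proof
    show "range (\<lambda>x. (- 2) *\<^sub>C fourier G x) \<subseteq> cvs.span G"
      by (auto intro!: cvs.span_neg cvs.span_scale fourier_in_span)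
    show "cvs.span G \<subseteq> range (\<lambda>x. (- 2) *\<^sub>C fourier G x)"
    proof
      fix y assume "y \<in> cvs.span G"
      then have "fourier G ((- (1 / 2)) *\<^sub>C y) = (- (1 / 2)) *\<^sub>C y"
        by (simp only: fourier_scaleC fourier_span[OF G])
      then have "y = (- 2) *\<^sub>C fourier G ((- (1 / 2)) *\<^sub>C y)"
        by (simp add: scaleC_scaleC scaleC_one)
      then show "y \<in> range (\<lambda>x. (- 2) *\<^sub>C fourier G x)"
        by (rule range_eqI)
    qed
  qed
  then have "(\<lambda>x. ?u x - x) \<in> finite_rank"
    unfolding diff finite_rank_def using P2[of "- 2"] G(1) by auto
  moreover have "?u \<in> unitary_group"
    using u adj inv unfolding unitary_group_def by blast
  ultimately show ?thesis
    by (simp add: U_fin_def)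
qed

text \<open>The exchange of \<open>a\<close> with \<open>h a\<close> is the reflection along the vectors \<open>(a - h a) / sqrt 2\<close>.\<close>

lemma exchange_exists:
  assumes A: "finite A" "orthonormal A" and B: "orthonormal B" and h: "bij_betw h A B"
    and orth: "\<And>a b. a \<in> A \<Longrightarrow> b \<in> B \<Longrightarrow> cinner a b = 0"
  obtains u where "u \<in> U_fin" "\<And>a. a \<in> A \<Longrightarrow> u a = h a" "\<And>a. a \<in> A \<Longrightarrow> u (h a) = a"
    "\<And>r. (\<And>k. k \<in> A \<union> B \<Longrightarrow> cinner k r = 0) \<Longrightarrow> u r = r"
proof -
  \<comment> \<open>The vectors \<open>a - h a\<close> have squared norm 2; \<open>s\<close>
    normalises them.\<close>
  define s :: complex where "s = of_real (1 / sqrt 2)"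
  have s: "cnj s = s" "s * s = 1 / 2" "s \<noteq> 0"
    by (simp_all add: s_def flip: of_real_mult)
  define g where "g a = s *\<^sub>C (a - h a)" for a
  define G where "G = g ` A"
  have hB: "h a \<in> B" if "a \<in> A" for a
    using h that by (auto simp: bij_betw_def)
  have hh: "cinner (h a) (h b) = cinner a b" if "a \<in> A" "b \<in> A" for a b
    using A(2) B hB h that by (auto simp: orthonormal_def bij_betw_def inj_on_def)
  have ah: "cinner a (h b) = 0" "cinner (h b) a = 0" if "a \<in> A" "b \<in> A" for a b
    using orth[OF that(1) hB[OF that(2)]] cinner_commute[of "h b" a] by simp_all
  have gg: "cinner (g a) (g b) = cinner a b" if "a \<in> A" "b \<in> A" for a b
  proof -
    have "cinner (g a) (g b) = (s * s) * (2 * cinner a b)"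
      using that by (simp add: g_def cinner_simps s(1) hh ah algebra_simps)
    then show ?thesis
      by (simp add: s(2))
  qed
  have G: "finite G" "orthonormal G"
  proof -
    show "finite G"
      using A(1) by (simp add: G_def)
    \<comment> \<open>Equal values \<open>g a = g b\<close> force \<open>a = b\<close>, because
      \<open>g\<close> preserves inner products on \<open>A\<close>.\<close>
    have "cinner (g a) (g b) = (if g a = g b then 1 else 0)" if "a \<in> A" "b \<in> A" for a b
      using gg[OF that] gg[OF that(1) that(1)] A(2) that unfolding orthonormal_def by metis
    then show "orthonormal G"
      by (auto simp: G_def orthonormal_def)
  qed
  define u where "u = (\<lambda>x. x - 2 *\<^sub>C fourier G x)"
  have U: "u \<in> U_fin"
    unfolding u_def using G by (rule reflection_U_fin)
  have uh: "u a = h a" "u (h a) = a" if a: "a \<in> A" for a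
  proof -
    have "g a \<in> cvs.span G"
      using a by (auto simp: G_def intro: cvs.span_base)
    then have "(1 / s) *\<^sub>C g a \<in> cvs.span G"
      by (rule cvs.span_scale)
    then have "a - h a \<in> cvs.span G"
      using s(3) by (simp add: g_def scaleC_scaleC scaleC_one)
    then have minus: "fourier G (a - h a) = a - h a"
      by (rule fourier_span[OF G])
    \<comment> \<open>The projection fixes \<open>a - h a\<close> and kills \<open>a + h a\<close>,
      so twice the projection of \<open>a\<close> is \<open>a - h a\<close>.\<close>
    have "fourier G (a + h a) = 0"
    proof (rule fourier_orthogonal)
      fix e assume "e \<in> G"
      then obtain b where "b \<in> A" "e = g b"
        by (auto simp: G_def)
      then show "cinner e (a + h a) = 0"
        using a by (simp add: g_def cinner_simps hh ah)
    qed
    then have fh: "fourier G (h a) = - fourier G a"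
      by (simp add: fourier_add eq_neg_iff_add_eq_0 add.commute)
    have "fourier G a = fourier G (a - h a) + fourier G (h a)"
      by (simp flip: fourier_add)
    then have "fourier G a + fourier G a = a - h a"
      by (simp add: minus fh eq_diff_eq)
    then have two: "2 *\<^sub>C fourier G a = a - h a"
      using scaleC_add_left[of 1 1 "fourier G a"] by (simp add: scaleC_one)
    show "u a = h a" "u (h a) = a"
      by (simp_all add: u_def fh two cvs.scale_minus_right)
  qed
  have "u r = r" if "\<And>k. k \<in> A \<union> B \<Longrightarrow> cinner k r = 0" for r
  proof -
    have "fourier G r = 0"
      using that hB by (intro fourier_orthogonal) (auto simp: G_def g_def cinner_simps)
    then show ?thesis
      by (simp add: u_def)
  qed
  with U uh show thesis
    by (rule that)
qed

section \<open>From growing commutators to unboundedness\<close>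

lemma U_fin_hilbert_schmidt:
  fixes E :: "'a::complex_hilbert set" and u :: "'a \<Rightarrow> 'a"
  assumes "u \<in> U_fin" "orthonormal_basis_on UNIV E"
  shows "(\<lambda>x. u x - x) \<in> hilbert_schmidt_on UNIV"
proof -
  obtain b where "adjoint_on UNIV (\<lambda>x. u x - x) b"
    using assms(1) adjoint_diff_id by (auto simp: U_fin_def unitary_group_def)
  then show ?thesis
    using assms by (intro finite_rank_hilbert_schmidt) (auto simp: U_fin_def)
qed

text \<open>The operator norm part of \<open>res_norm\<close> is nonnegative, so the Hilbert-Schmidt
  part alone forces unboundedness.\<close>

lemma unbounded_subset_B_resI:
  assumes "X \<subseteq> B_res Hp Hm"
    and "\<And>n. \<exists>u\<in>X. 2 * sqrt (real n) \<le> hs_norm (comm_op (d_op Hp Hm) u)"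
  shows "unbounded_subset_B_res Hp Hm X"
  unfolding unbounded_subset_B_res_def
proof (intro conjI assms(1) notI)
  assume "\<exists>C. \<forall>a\<in>X. res_norm Hp Hm a \<le> C"
  then obtain C where C: "\<And>a. a \<in> X \<Longrightarrow> res_norm Hp Hm a \<le> C"
    by blast
  \<comment> \<open>Comparing with the square of \<open>C\<close> covers negative \<open>C\<close>
    too.\<close>
  obtain n :: nat where n: "C\<^sup>2 < real n"
    using reals_Archimedean2 by blast
  obtain u where u: "u \<in> X" "2 * sqrt (real n) \<le> hs_norm (comm_op (d_op Hp Hm) u)"
    using assms(2) by blast
  have "bounded_linear u"
    using u(1) assms(1) bounded_op_bounded_linear by (auto simp: B_res_def)
  then have "2 * sqrt (real n) \<le> C"
    using u(2) C[OF u(1)] onorm_pos_le[of u] by (simp add: res_norm_def)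
  moreover have "\<bar>C\<bar> < sqrt (real n)"
    using n by (simp add: real_less_rsqrt)
  ultimately show False
    by linarith
qed

theorem proposition6p2:
  fixes Hp Hm :: "'a::complex_hilbert set"
  assumes "separable_space (euclidean :: 'a topology)"
    and "cvs.subspace Hp" and "closed Hp" and "infinite_dim Hp"
    and "cvs.subspace Hm" and "closed Hm" and "infinite_dim Hm"
    and "orth_sum Hp Hm"
  shows "unbounded_subset_B_res Hp Hm U_fin \<and>
         unbounded_subset_B_res Hp Hm (U_12 Hp Hm) \<and>
         unbounded_subset_B_res Hp Hm (U_res Hp Hm)"
proof -
  interpret polarization Hp Hm
    using assms by unfold_locales
  \<comment> \<open>The trivial decomposition makes the whole space another instance of the basis
    lemma.\<close>
  have "orth_sum UNIV {0 :: 'a}"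
    by (simp add: orth_sum_def)
  from orth_sum_basis_exists[OF assms(1) cvs.subspace_UNIV closed_UNIV this cvs.subspace_single_0]
  obtain E :: "'a set" where E: "orthonormal_basis_on UNIV E" .
  obtain Ep where Ep: "orthonormal_basis_on Hp Ep"
    using orth_sum_basis_exists[OF assms(1) assms(2,3,8,5)] .
  obtain Em where Em: "orthonormal_basis_on Hm Em"
    using orth_sum_basis_exists[OF assms(1) assms(5,6) orth_sum_sym[OF assms(8)] assms(2)] .
  have fin: "U_fin \<subseteq> B_res Hp Hm"
    using unitary_in_B_res U_fin_hilbert_schmidt[OF _ E] by (auto simp: U_fin_def)
  \<comment> \<open>One witness serves all three sets, as \<open>U_fin\<close> is contained in
    \<open>U_res\<close>.\<close>
  have "\<exists>u. u \<in> U_fin \<and> u \<in> U_12 Hp Hm \<and> 2 * sqrt (real n) \<le> hs_norm (comm_op d u)" for n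
  proof -
    obtain A where A: "A \<subseteq> Hp" "finite A" "orthonormal A" "card A = n"
      using infinite_dim_orthonormal[OF assms(2,4)] by blast
    obtain B where B: "B \<subseteq> Hm" "finite B" "orthonormal B" "card B = n"
      using infinite_dim_orthonormal[OF assms(5,7)] by blast
    obtain h where h: "bij_betw h A B"
      using finite_same_card_bij[OF A(2) B(2)] A(4) B(4) by auto
    obtain u where u: "u \<in> U_fin" "\<And>a. a \<in> A \<Longrightarrow> u a = h a" "\<And>a. a \<in> A \<Longrightarrow> u (h a) = a"
        "\<And>r. (\<And>k. k \<in> A \<union> B \<Longrightarrow> cinner k r = 0) \<Longrightarrow> u r = r"
      using exchange_exists[OF A(2,3) B(3) h] A(1) B(1) cinner_pm by blast
    have un: "u \<in> unitary_group" and ub: "bounded_op_on UNIV u"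
      using u(1) by (auto simp: U_fin_def unitary_group_def)
    have hs: "(\<lambda>x. u x - x) \<in> hilbert_schmidt_on UNIV"
      using u(1) E by (rule U_fin_hilbert_schmidt)
    have uA: "u ` A = B"
      using u(2) h by (simp add: bij_betw_def cong: image_cong)
    have uB: "u b \<in> Hp" if "b \<in> B" for b
      using that uA u(2,3) A(1) by force
    have "orth_proj Hp (u x) - x = - fourier A x" if "x \<in> Hp" for x
      using assms(8,2,5) A(2,3,1) ub _ _ that
    proof (rule orth_proj_swap)
      show "u a \<in> Hm" if "a \<in> A" for a
        using that uA B(1) by blast
      \<comment> \<open>Orthogonality to \<open>B\<close> is automatic for \<open>r\<close> in
        \<open>Hp\<close>, since \<open>B\<close> lies in \<open>Hm\<close>.\<close>
      show "u r = r" if "r \<in> Hp" "\<And>a. a \<in> A \<Longrightarrow> cinner a r = 0" for r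
        using that B(1) cinner_mp by (intro u(4)) blast
    qed
    then have "(\<lambda>x. orth_proj Hp (u x) - x) \<in> trace_class_on Hp"
      by (rule trace_class_minus_fourier[OF A(2,3,1) assms(2) Ep])
    moreover have "orth_proj Hm (u x) - x = - fourier B x" if "x \<in> Hm" for x
      using orth_sum_sym[OF assms(8)] assms(5,2) B(2,3,1) ub uB _ that
    proof (rule orth_proj_swap)
      show "u r = r" if "r \<in> Hm" "\<And>a. a \<in> B \<Longrightarrow> cinner a r = 0" for r
        using that A(1) cinner_pm by (intro u(4)) blast
    qed
    then have "(\<lambda>x. orth_proj Hm (u x) - x) \<in> trace_class_on Hm"
      by (rule trace_class_minus_fourier[OF B(2,3,1) assms(5) Em])
    ultimately have "u \<in> U_12 Hp Hm"
      using un hs by (simp add: U_12_def)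
    moreover have "2 * sqrt (real n) \<le> hs_norm (comm_op d u)"
      using hs_norm_comm_ge[OF un hs A(2,3,1)] uA B(1,3) A(4) by simp
    ultimately show ?thesis
      using u(1) by blast
  qed
  moreover have "U_12 Hp Hm \<subseteq> B_res Hp Hm"
    using unitary_in_B_res by (auto simp: U_12_def)
  moreover have "U_fin \<subseteq> U_res Hp Hm" "U_res Hp Hm \<subseteq> B_res Hp Hm"
    using fin by (auto simp: U_res_def U_fin_def)
  ultimately show ?thesis
    using fin by (intro conjI unbounded_subset_B_resI) blast+
qed

end
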